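(* Let $n\ge1$, $\delta>0$ and let $\beta<n+2$ be real. Then for every $u\in C^2(\mathbb{R}^n)$ and $x\in\mathbb{R}^n$, $$\Delta u(x)+c^{\delta,\beta}\int_{B_\delta(0)}\frac{u(x+z)-u(x)-\nabla\nabla u(x):\frac{z\otimes z}{2}}{\|z\|^\beta}\,dz = c^{\delta,\beta}\int_{B_\delta(0)}\frac{u(x+z)-u(x)}{\|z\|^\beta}\,dz .$$ Moreover, for every $\nu\in\mathbb{R}^n$, $$-\|\nu\|^2+c^{\delta,\beta}\int_{B_\delta(0)}\frac{\cos(\nu\cdot z)-1+\frac{(\nu\cdot z)^2}{2}}{\|z\|^\beta}\,dz = c^{\delta,\beta}\int_{B_\delta(0)}\frac{\cos(\nu\cdot z)-1}{\|z\|^\beta}\,dz .$$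
   Context: The scaling constant is $c^{\delta,\beta}=\frac{2(n+2-\beta)\Gamma(\frac n2+1)}{\pi^{n/2}\delta^{n+2-\beta}}$. $B_\delta(0)$ is the ball of radius $\delta$ centered at $0$ in $\mathbb{R}^n$; $\nabla\nabla u(x)$ is the Hessian, $A:B=\sum_{i,j}A_{ij}B_{ij}$, so $\nabla\nabla u(x):\frac{z\otimes z}{2}=\frac12\sum_{i,j}\partial_i\partial_ju(x)z_iz_j$. The singular integrals involving $u$ are understood as $\lim_{\epsilon\to0^+}\int_{B_\delta(0)\setminus B_\epsilon(0)}$ (principal value) when not absolutely convergent. *)

theory Defs
  imports "HOL-Analysis.Analysis"
begin

definition scaling_const :: "nat \<Rightarrow> real \<Rightarrow> real \<Rightarrow> real" where
  "scaling_const n \<delta> \<beta> =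
     2 * (real n + 2 - \<beta>) * Gamma (real n / 2 + 1) /
     (pi powr (real n / 2) * \<delta> powr (real n + 2 - \<beta>))"

definition has_partial :: "'n::finite \<Rightarrow> (real ^ 'n \<Rightarrow> real) \<Rightarrow> real ^ 'n \<Rightarrow> bool" where
  "has_partial i u x \<longleftrightarrow> (\<lambda>t::real. u (x + t *\<^sub>R axis i 1)) differentiable (at 0)"

definition partial :: "'n::finite \<Rightarrow> (real ^ 'n \<Rightarrow> real) \<Rightarrow> real ^ 'n \<Rightarrow> real" where
  "partial i u x = deriv (\<lambda>t::real. u (x + t *\<^sub>R axis i 1)) 0"

primrec C_k_on_UNIV :: "nat \<Rightarrow> (real ^ 'n::finite \<Rightarrow> real) \<Rightarrow> bool" where
  "C_k_on_UNIV 0 u \<longleftrightarrow> continuous_on UNIV u"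
| "C_k_on_UNIV (Suc k) u \<longleftrightarrow>
     continuous_on UNIV u \<and> (\<forall>i. (\<forall>x. has_partial i u x) \<and> C_k_on_UNIV k (partial i u))"

definition hessian :: "(real ^ 'n::finite \<Rightarrow> real) \<Rightarrow> real ^ 'n \<Rightarrow> real ^ 'n ^ 'n" where
  "hessian u x = (\<chi> i j. partial i (partial j u) x)"

definition laplacian :: "(real ^ 'n::finite \<Rightarrow> real) \<Rightarrow> real ^ 'n \<Rightarrow> real" where
  "laplacian u x = (\<Sum>i\<in>UNIV. partial i (partial i u) x)"

definition outer_prod :: "real ^ 'n::finite \<Rightarrow> real ^ 'n \<Rightarrow> real ^ 'n ^ 'n" where
  "outer_prod v w = (\<chi> i j. v $ i * w $ j)"

definition contract :: "real ^ 'n::finite ^ 'n \<Rightarrow> real ^ 'n ^ 'n \<Rightarrow> real" where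
  "contract A B = (\<Sum>i\<in>UNIV. \<Sum>j\<in>UNIV. A $ i $ j * B $ i $ j)"

definition has_pv_integral :: "real \<Rightarrow> (real ^ 'n::finite \<Rightarrow> real) \<Rightarrow> real \<Rightarrow> bool" where
  "has_pv_integral \<delta> f I \<longleftrightarrow>
     (\<forall>\<epsilon>>0. set_integrable lborel (ball 0 \<delta> - ball 0 \<epsilon>) f) \<and>
     ((\<lambda>\<epsilon>. LINT z:(ball 0 \<delta> - ball 0 \<epsilon>)|lborel. f z) \<longlongrightarrow> I) (at_right 0)"

text \<open>An integral over the ball of radius \<open>\<delta>\<close> about the origin: the Lebesgue integral if it
  converges absolutely, otherwise the principal value at the origin. The value is meaningful
  only under \<open>sing_convergent\<close>.\<close>

definition sing_convergent :: "real \<Rightarrow> (real ^ 'n::finite \<Rightarrow> real) \<Rightarrow> bool" where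
  "sing_convergent \<delta> f \<longleftrightarrow>
     set_integrable lborel (ball 0 \<delta>) f \<or> (\<exists>I. has_pv_integral \<delta> f I)"

definition sing_integral :: "real \<Rightarrow> (real ^ 'n::finite \<Rightarrow> real) \<Rightarrow> real" where
  "sing_integral \<delta> f =
     (if set_integrable lborel (ball 0 \<delta>) f then LINT z:ball 0 \<delta>|lborel. f z
      else (THE I. has_pv_integral \<delta> f I))"

end

(* By the sign changes and permutations of the coordinates, the moments of z_i z_j / |z|^beta over
   the ball vanish for i <> j and all agree for i = j.  Their common value follows from the trace,
   which is a radial integral, and the constant is chosen so that c/2 times it is 1: hence c times
   the integral of A : (z (x) z)/2 / |z|^beta is tr A, and both identities are linearity of the
   integral.  The difference quotient of u has a principal value because its odd part integrates to
   zero over every annulus, while the second difference u(x+z) + u(x-z) - 2 u(x) is O(|z|^2), so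
   that the even part is absolutely integrable. *)

theory Submission imports Defs begin

section \<open>Signed coordinate permutations and Lebesgue measure\<close>

lemma prod_Basis_cart: "(\<Prod>b\<in>Basis. (v :: real ^ 'n::finite) \<bullet> b) = (\<Prod>i\<in>UNIV. v $ i)"
proof -
  have B: "(Basis :: (real ^ 'n) set) = range (\<lambda>i. axis i 1)"
    by (auto simp: Basis_vec_def)
  have inj: "inj (\<lambda>i::'n. axis i (1::real))"
    by (auto simp: inj_on_def axis_eq_axis)
  show ?thesis
    unfolding B by (subst prod.reindex[OF inj]) (simp add: inner_axis)
qed

lemma signed_perm_measurable [measurable]:
  "(\<lambda>z :: real ^ 'n::finite. (\<chi> k. s k * z $ p k) :: real ^ 'n) \<in> borel_measurable borel"
  by (intro borel_measurable_continuous_onI continuous_intros)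

text \<open>Lebesgue measure is determined by its values on boxes, and the preimage of a box under a
  signed permutation is a box whose side lengths are the old ones in another order.\<close>

lemma distr_lborel_signed_perm:
  fixes s :: "'n::finite \<Rightarrow> real" and p :: "'n \<Rightarrow> 'n"
  assumes s: "\<And>k. \<bar>s k\<bar> = 1" and p: "bij p"
  shows "distr lborel borel (\<lambda>z :: real ^ 'n. \<chi> k. s k * z $ p k) = lborel"
proof (rule lborel_eqI[symmetric])
  let ?T = "\<lambda>z :: real ^ 'n. (\<chi> k. s k * z $ p k) :: real ^ 'n"
  fix l u :: "real ^ 'n"
  assume lu: "\<And>b. b \<in> Basis \<Longrightarrow> l \<bullet> b \<le> u \<bullet> b"
  have le: "l $ k \<le> u $ k" for k
    using lu[of "axis k 1"] by (simp add: inner_axis)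
  define q where "q = inv p"
  have qp: "q (p k) = k" "p (q k) = k" for k
    using p by (simp_all add: q_def bij_is_inj bij_is_surj surj_f_inv_f)
  \<comment> \<open>Coordinate \<open>m\<close> of the argument enters component \<open>q m\<close>
    of the image; a sign -1 there reflects the interval between \<open>l\<close> and
    \<open>u\<close> to the one between \<open>- u\<close> and \<open>- l\<close>.\<close>
  define a where "a = (\<chi> m. if s (q m) = 1 then l $ q m else - u $ q m)"
  define b where "b = (\<chi> m. if s (q m) = 1 then u $ q m else - l $ q m)"
  have s': "s k = 1 \<or> s k = -1" for k
    using s[of k] by linarith
  have coord: "(l $ k < s k * z $ p k \<and> s k * z $ p k < u $ k) \<longleftrightarrow> (a $ p k < z $ p k \<and> z $ p k < b $ p k)"
    for k and z :: "real ^ 'n"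
    using s'[of k] by (auto simp: a_def b_def qp)
  have vim: "?T -` box l u = box a b"
  proof (intro set_eqI)
    fix z
    have "z \<in> ?T -` box l u \<longleftrightarrow> (\<forall>k. a $ p k < z $ p k \<and> z $ p k < b $ p k)"
      by (simp add: mem_box_cart coord)
    also have "\<dots> \<longleftrightarrow> z \<in> box a b"
      unfolding mem_box_cart by (metis qp(2))
    finally show "z \<in> ?T -` box l u \<longleftrightarrow> z \<in> box a b" .
  qed
  have ab: "a \<bullet> c \<le> b \<bullet> c" if "c \<in> Basis" for c
    using that le by (auto simp: Basis_vec_def inner_axis a_def b_def)
  have "emeasure (distr lborel borel ?T) (box l u) = emeasure lborel (box a b)"
    by (subst emeasure_distr) (auto simp: vim)
  also have "\<dots> = (\<Prod>c\<in>Basis. (b - a) \<bullet> c)"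
    using ab by simp
  also have "(\<Prod>c\<in>Basis. (b - a) \<bullet> c) = (\<Prod>m\<in>UNIV. (u - l) $ q m)"
    unfolding prod_Basis_cart by (intro prod.cong) (auto simp: a_def b_def)
  also have "\<dots> = (\<Prod>k\<in>UNIV. (u - l) $ k)"
    using p by (intro prod.reindex_bij_betw) (simp add: q_def bij_imp_bij_inv)
  also have "\<dots> = (\<Prod>c\<in>Basis. (u - l) \<bullet> c)"
    by (rule prod_Basis_cart[symmetric])
  finally show "emeasure (distr lborel borel ?T) (box l u) = ennreal (\<Prod>c\<in>Basis. (u - l) \<bullet> c)" .
qed simp

lemma norm_signed_perm:
  fixes z :: "real ^ 'n::finite" and p :: "'n \<Rightarrow> 'n"
  assumes s: "\<And>k. \<bar>s k\<bar> = 1" and p: "bij p"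
  shows "norm (\<chi> k. s k * z $ p k) = norm z"
proof -
  have "(\<Sum>k\<in>UNIV. (s k * z $ p k)\<^sup>2) = (\<Sum>k\<in>UNIV. (z $ p k)\<^sup>2)"
  proof (intro sum.cong refl)
    fix k
    have "(s k)\<^sup>2 = 1" using s[of k] by (metis power2_abs one_power2)
    then show "(s k * z $ p k)\<^sup>2 = (z $ p k)\<^sup>2" by (simp add: power_mult_distrib)
  qed
  also have "\<dots> = (\<Sum>k\<in>UNIV. (z $ k)\<^sup>2)"
    using p by (rule sum.reindex_bij_betw)
  finally show ?thesis
    by (simp add: norm_vec_def L2_set_def)
qed

lemma integral_signed_perm:
  fixes f :: "real ^ 'n::finite \<Rightarrow> real" and p :: "'n \<Rightarrow> 'n"
  assumes s: "\<And>k. \<bar>s k\<bar> = 1" and p: "bij p" and [measurable]: "f \<in> borel_measurable borel"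
  shows "(\<integral>z. f (\<chi> k. s k * z $ p k) \<partial>lborel) = (\<integral>z. f z \<partial>lborel)"
    and "integrable lborel (\<lambda>z. f (\<chi> k. s k * z $ p k)) \<longleftrightarrow> integrable lborel f"
  using integral_distr[of "\<lambda>z. \<chi> k. s k * z $ p k" lborel borel f]
    integrable_distr_eq[of "\<lambda>z. \<chi> k. s k * z $ p k" lborel borel f]
  by (simp_all add: distr_lborel_signed_perm s p)

section \<open>Radial integrals over a ball\<close>

text \<open>This is the radial half of polar coordinates. Two measures on the line that are finite
  and agree on all half-lines \<open>{r<..}\<close> are equal; on the left such a half-line gives
  the volume of a ball minus a closed ball, on the right the fundamental theorem of calculus gives
  the same number.\<close>

lemma distr_norm_ball:
  fixes \<delta> :: real
  assumes "\<delta> > 0"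
  shows "distr (density lborel (indicator (ball 0 \<delta>))) borel (norm :: 'a::euclidean_space \<Rightarrow> real) =
    density lborel (\<lambda>t. ennreal (DIM('a) * unit_ball_vol DIM('a) * t ^ (DIM('a) - 1)) * indicator {0..\<delta>} t)"
    (is "?M = ?N")
proof (rule measure_eqI_lessThan)
  let ?n = "DIM('a)" and ?\<omega> = "unit_ball_vol DIM('a)"
  have [measurable]: "(indicator (ball (0::'a) \<delta>) :: 'a \<Rightarrow> ennreal) \<in> borel_measurable borel"
    by (rule borel_measurable_indicator) simp
  have M: "emeasure ?M {r<..} = emeasure lborel (ball (0::'a) \<delta> - cball 0 r)" for r
  proof -
    have [measurable]: "{z::'a. r < norm z} \<in> sets borel" by measurable
    have "emeasure ?M {r<..} = emeasure (density lborel (indicator (ball (0::'a) \<delta>))) {z. r < norm z}"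
      by (subst emeasure_distr) (auto simp: vimage_def)
    also have "\<dots> = emeasure lborel (ball (0::'a) \<delta> \<inter> {z. r < norm z})"
      by (subst emeasure_density)
        (auto simp: indicator_inter_arith[symmetric] nn_integral_indicator)
    also have "ball (0::'a) \<delta> \<inter> {z. r < norm z} = ball (0::'a) \<delta> - cball 0 r"
      by auto
    finally show ?thesis .
  qed
  have N: "emeasure ?N {r<..} = ennreal (?\<omega> * \<delta> ^ ?n - ?\<omega> * r ^ ?n)" if r: "0 \<le> r" "r \<le> \<delta>" for r
  proof -
    have "emeasure ?N {r<..} = (\<integral>\<^sup>+t. ennreal (?n * ?\<omega> * t ^ (?n - 1)) * indicator {0..\<delta>} t * indicator {r<..} t \<partial>lborel)"
      by (subst emeasure_density) auto
    also have "\<dots> = (\<integral>\<^sup>+t. ennreal (?n * ?\<omega> * t ^ (?n - 1)) * indicator {r..\<delta>} t \<partial>lborel)"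
      using AE_lborel_singleton[of r] r
      by (intro nn_integral_cong_AE) (auto elim!: eventually_mono split: split_indicator)
    also have "\<dots> = ennreal (?\<omega> * \<delta> ^ ?n - ?\<omega> * r ^ ?n)"
      using r by (intro nn_integral_FTC_Icc) (auto intro!: derivative_eq_intros)
    finally show ?thesis .
  qed
  have n0: "?n > 0" by simp
  fix r
  show "emeasure ?M {r<..} < \<infinity>"
  proof -
    have "emeasure lborel (ball (0::'a) \<delta> - cball 0 r) \<le> emeasure lborel (ball (0::'a) \<delta>)"
      by (intro emeasure_mono) auto
    also have "\<dots> < \<infinity>" using emeasure_lborel_ball_finite .
    finally show ?thesis unfolding M .
  qed
  consider "r < 0" | "0 \<le> r" "r \<le> \<delta>" | "r > \<delta>" by linarith
  then show "emeasure ?M {r<..} = emeasure ?N {r<..}"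
  proof cases
    \<comment> \<open>For negative \<open>r\<close> the removed closed ball is empty, and the
      density lives on \<open>{0..\<delta>}\<close>, so up to the null set \<open>{0}\<close> the
      value is the one for \<open>r = 0\<close>.\<close>
    case 1
    have "emeasure ?M {r<..} = ennreal (?\<omega> * \<delta> ^ ?n)"
      using 1 assms by (simp add: M emeasure_ball)
    moreover have "emeasure ?N {r<..} = emeasure ?N {0<..}"
    proof -
      have "emeasure ?N {r<..} = (\<integral>\<^sup>+t. ennreal (?n * ?\<omega> * t ^ (?n - 1)) * indicator {0..\<delta>} t * indicator {r<..} t \<partial>lborel)"
        by (subst emeasure_density) auto
      also have "\<dots> = (\<integral>\<^sup>+t. ennreal (?n * ?\<omega> * t ^ (?n - 1)) * indicator {0..\<delta>} t * indicator {0<..} t \<partial>lborel)"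
        using AE_lborel_singleton[of 0] 1
        by (intro nn_integral_cong_AE) (auto elim!: eventually_mono split: split_indicator)
      also have "\<dots> = emeasure ?N {0<..}"
        by (subst emeasure_density) auto
      finally show ?thesis .
    qed
    ultimately show ?thesis
      using N[of 0] assms by (simp add: n0)
  next
    case 2
    have "emeasure lborel (ball (0::'a) \<delta> - cball 0 r) = ennreal (?\<omega> * \<delta> ^ ?n - ?\<omega> * r ^ ?n)"
    \<comment> \<open>Subtracting the measures requires the closed ball to lie inside the open one,
      which fails at \<open>r = \<delta>\<close>; there the difference is empty.\<close>
    proof (cases "r < \<delta>")
      case True
      have "emeasure lborel (ball (0::'a) \<delta> - cball 0 r) = emeasure lborel (ball (0::'a) \<delta>) - emeasure lborel (cball (0::'a) r)"
        using True 2 emeasure_lborel_cball_finite[of "0::'a" r] by (intro emeasure_Diff) auto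
      then show ?thesis
        using 2 assms by (simp add: emeasure_ball emeasure_cball ennreal_minus)
    next
      case False
      then have "r = \<delta>" using 2 by simp
      then have "ball (0::'a) \<delta> - cball 0 r = {}" by auto
      then show ?thesis unfolding \<open>r = \<delta>\<close> by (simp only: emeasure_empty) simp
    qed
    then show ?thesis
      using M N 2 by simp
  next
    case 3
    have "ball (0::'a) \<delta> - cball 0 r = {}" using 3 by auto
    then have "emeasure ?M {r<..} = 0" unfolding M by (simp only: emeasure_empty)
    moreover have "emeasure ?N {r<..} \<le> emeasure ?N {\<delta><..}"
      using 3 by (intro emeasure_mono) auto
    moreover have "emeasure ?N {\<delta><..} = 0"
      using N[of \<delta>] assms by simp
    ultimately show ?thesis by simp
  qed
qed auto

text \<open>The law of the norm turns this into n times the unit ball volume times the integral of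
  t^(n-1+a) over [0, delta], which converges because n + a > 0. The exponent of interest is a = 2 -
  beta, for which the condition reads beta < n + 2.\<close>

lemma has_bochner_integral_norm_powr_ball:
  fixes \<delta> a :: real
  assumes "\<delta> > 0" and a: "a > - real DIM('a)"
  shows "has_bochner_integral lborel (\<lambda>z :: 'a::euclidean_space. indicator (ball 0 \<delta>) z *\<^sub>R norm z powr a)
    (DIM('a) * unit_ball_vol DIM('a) * \<delta> powr (DIM('a) + a) / (DIM('a) + a))"
proof (rule has_bochner_integral_nn_integral)
  let ?n = "DIM('a)" and ?\<omega> = "unit_ball_vol DIM('a)"
  let ?c = "?n * ?\<omega>"
  have [measurable]: "(indicator (ball (0::'a) \<delta>) :: 'a \<Rightarrow> ennreal) \<in> borel_measurable borel"
    by (rule borel_measurable_indicator) simp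
  \<comment> \<open>At \<open>t = 0\<close> both sides vanish, because \<open>0 powr a = 0\<close>
    for every \<open>a\<close>; this covers n = 1 too, where \<open>t ^ (?n - 1)\<close> is
    1.\<close>
  have pw: "t ^ (?n - 1) * t powr a = t powr (real ?n - 1 + a)" if "t \<ge> 0" for t :: real
  proof (cases "t = 0")
    case False
    then have "t ^ (?n - 1) = t powr (real ?n - 1)"
      using that by (subst powr_realpow[symmetric]) (auto simp: of_nat_diff Suc_le_eq)
    then show ?thesis by (simp add: powr_add)
  qed simp
  have "(\<integral>\<^sup>+z. ennreal (indicator (ball (0::'a) \<delta>) z *\<^sub>R norm z powr a) \<partial>lborel) =
      (\<integral>\<^sup>+z. indicator (ball (0::'a) \<delta>) z * ennreal (norm z powr a) \<partial>lborel)"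
    by (intro nn_integral_cong) (auto split: split_indicator)
  also have "\<dots> = (\<integral>\<^sup>+z. ennreal (norm z powr a) \<partial>density lborel (indicator (ball (0::'a) \<delta>)))"
    by (subst nn_integral_density) auto
  also have "\<dots> = (\<integral>\<^sup>+t. ennreal (t powr a) \<partial>distr (density lborel (indicator (ball (0::'a) \<delta>))) borel norm)"
    by (subst nn_integral_distr) auto
  also have "\<dots> = (\<integral>\<^sup>+t. ennreal (?c * t ^ (?n - 1)) * indicator {0..\<delta>} t * ennreal (t powr a) \<partial>lborel)"
    unfolding distr_norm_ball[OF assms(1)] by (subst nn_integral_density) auto
  also have "\<dots> = (\<integral>\<^sup>+t. ennreal (indicator {0..\<delta>} t * (?c * t powr (real ?n - 1 + a))) \<partial>lborel)"
    by (intro nn_integral_cong)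
      (auto split: split_indicator simp: ennreal_mult[symmetric] pw[symmetric] mult.assoc)
  also have "\<dots> = ennreal (?c * (\<delta> powr (real ?n - 1 + a + 1) / (real ?n - 1 + a + 1)))"
  proof (rule nn_integral_has_integral_lborel)
    have "((\<lambda>t. ?c * t powr (real ?n - 1 + a)) has_integral
        ?c * (\<delta> powr (real ?n - 1 + a + 1) / (real ?n - 1 + a + 1))) {0..\<delta>}"
      using a assms by (intro has_integral_mult_right has_integral_powr_from_0) auto
    then show "((\<lambda>t. indicator {0..\<delta>} t * (?c * t powr (real ?n - 1 + a))) has_integral
        ?c * (\<delta> powr (real ?n - 1 + a + 1) / (real ?n - 1 + a + 1))) UNIV"
      by (subst (asm) has_integral_restrict_UNIV[symmetric], elim has_integral_eq[rotated])
        (auto split: split_indicator)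
  qed (auto simp: indicator_def)
  also have "?c * (\<delta> powr (real ?n - 1 + a + 1) / (real ?n - 1 + a + 1)) = ?c * \<delta> powr (?n + a) / (?n + a)"
    by (simp add: algebra_simps)
  finally show "(\<integral>\<^sup>+z. ennreal (indicator (ball (0::'a) \<delta>) z *\<^sub>R norm z powr a) \<partial>lborel) =
      ennreal (?c * \<delta> powr (?n + a) / (?n + a))" .
qed (use assms in \<open>auto simp: indicator_def\<close>)

section \<open>Partial derivatives and the second difference of a C^2 function\<close>

text \<open>\<open>has_partial\<close> speaks of the derivative at parameter 0 only; moving the base
  point along the axis gives it at every parameter.\<close>

lemma has_partialD:
  assumes "\<And>x. has_partial i u x"
  shows "((\<lambda>t. u (x + t *\<^sub>R axis i 1)) has_real_derivative partial i u (x + t *\<^sub>R axis i 1)) (at t)"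
proof -
  have "((\<lambda>s. u ((x + t *\<^sub>R axis i 1) + s *\<^sub>R axis i 1)) has_real_derivative partial i u (x + t *\<^sub>R axis i 1)) (at 0)"
    using assms[of "x + t *\<^sub>R axis i 1"] unfolding has_partial_def partial_def
    by (simp add: DERIV_deriv_iff_real_differentiable)
  then have "((\<lambda>s. u (x + (s + t) *\<^sub>R axis i 1)) has_real_derivative partial i u (x + t *\<^sub>R axis i 1)) (at 0)"
    by (simp add: algebra_simps)
  then show ?thesis
    using DERIV_shift[of "\<lambda>t. u (x + t *\<^sub>R axis i 1)" _ 0 t] by simp
qed

text \<open>The mean value inequality, applied to \<open>u\<close> along the axis minus the linear
  function with slope \<open>d\<close>.\<close>

lemma partial_increment_bound:
  fixes u :: "real ^ 'n::finite \<Rightarrow> real"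
  assumes "\<And>x. has_partial i u x"
    and near: "\<And>t. \<bar>t\<bar> \<le> \<bar>c\<bar> \<Longrightarrow> \<bar>partial i u (y + t *\<^sub>R axis i 1) - d\<bar> \<le> e"
  shows "\<bar>u (y + c *\<^sub>R axis i 1) - u y - d * c\<bar> \<le> e * \<bar>c\<bar>"
proof -
  define g where "g = (\<lambda>t. u (y + t *\<^sub>R axis i 1) - d * t)"
  have g': "(g has_real_derivative partial i u (y + t *\<^sub>R axis i 1) - d) (at t)" for t
    unfolding g_def by (auto intro!: derivative_eq_intros has_partialD assms)
  have "norm (g c - g 0) \<le> e * norm (c - 0)"
  proof (rule field_differentiable_bound[where S = "cball 0 \<bar>c\<bar>" and f = g])
    show "(g has_field_derivative partial i u (y + t *\<^sub>R axis i 1) - d) (at t within cball 0 \<bar>c\<bar>)" for t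
      using g' by (rule has_field_derivative_at_within)
    show "norm (partial i u (y + t *\<^sub>R axis i 1) - d) \<le> e" if "t \<in> cball 0 \<bar>c\<bar>" for t
      using near that by simp
  qed auto
  then show ?thesis
    by (simp add: g_def algebra_simps)
qed

text \<open>Continuity of the partials at \<open>x\<close> gives the total derivative: pass from
  \<open>x\<close> to \<open>y\<close> one coordinate at a time. Each of the n moves has an error of
  at most e/n times the norm of the displacement, which explains \<open>e'\<close>.\<close>

lemma has_derivative_partials:
  fixes u :: "real ^ 'n::finite \<Rightarrow> real"
  assumes ex: "\<And>i x. has_partial i u x" and cont: "\<And>i. isCont (partial i u) x"
  shows "(u has_derivative (\<lambda>h. \<Sum>i\<in>UNIV. partial i u x * h $ i)) (at x)"
  unfolding has_derivative_at_alt
proof (intro conjI allI impI)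
  show "bounded_linear (\<lambda>h. \<Sum>i\<in>UNIV. partial i u x * h $ i)"
    by (intro bounded_linear_sum bounded_linear_const_mult bounded_linear_vec_nth)
  fix e :: real
  assume "e > 0"
  define e' where "e' = e / real CARD('n)"
  have "e' > 0" using \<open>e > 0\<close> by (simp add: e'_def)
  have "\<exists>d>0. \<forall>y. norm (y - x) < d \<longrightarrow> \<bar>partial i u y - partial i u x\<bar> < e'" for i
    using cont[of i] \<open>e' > 0\<close> unfolding isCont_def LIM_eq
    by (metis diff_self real_norm_def abs_zero)
  then obtain D where D: "\<And>i. D i > 0"
    "\<And>i y. norm (y - x) < D i \<Longrightarrow> \<bar>partial i u y - partial i u x\<bar> < e'"
    by metis
  define d where "d = Min (range D)"
  have "d > 0" and dD: "d \<le> D i" for i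
    using D(1) by (auto simp: d_def)
  have "\<bar>u y - u x - (\<Sum>i\<in>UNIV. partial i u x * (y - x) $ i)\<bar> \<le> e * norm (y - x)"
    if y: "norm (y - x) < d" for y
  proof -
    define h where "h = y - x"
    \<comment> \<open>\<open>P S\<close> is the point reached from \<open>x\<close> once the
      coordinates in \<open>S\<close> have been moved to those of \<open>y\<close>.\<close>
    define P where "P = (\<lambda>S. x + (\<Sum>i\<in>S. h $ i *\<^sub>R axis i 1))"
    have Pc: "(P S - x) $ k = (if k \<in> S then h $ k else 0)" if "finite S" for S k
      using that by (simp add: P_def axis_def if_distrib cong: if_cong)
    have "\<bar>u (P S) - u x - (\<Sum>i\<in>S. partial i u x * h $ i)\<bar> \<le> (\<Sum>i\<in>S. e' * \<bar>h $ i\<bar>)" for S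
      using finite[of S]
    proof (induction S rule: finite_induct)
      case empty
      then show ?case by (simp add: P_def)
    next
      case (insert i S)
      have eq: "P (insert i S) = P S + h $ i *\<^sub>R axis i 1"
        using insert by (simp add: P_def)
      have "\<bar>u (P S + h $ i *\<^sub>R axis i 1) - u (P S) - partial i u x * h $ i\<bar> \<le> e' * \<bar>h $ i\<bar>"
      proof (rule partial_increment_bound[OF ex])
        fix t :: real
        assume t: "\<bar>t\<bar> \<le> \<bar>h $ i\<bar>"
        \<comment> \<open>Every point on the path differs from \<open>x\<close> in each coordinate
          by no more than \<open>y\<close> does, so the path stays where the partials are close to
          their values at \<open>x\<close>.\<close>
        have "norm (P S + t *\<^sub>R axis i 1 - x) \<le> norm h"
        proof (rule norm_le_componentwise_cart)
          fix k
          have "(P S + t *\<^sub>R axis i 1 - x) $ k = (P S - x) $ k + t * axis i 1 $ k"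
            by simp
          then show "norm ((P S + t *\<^sub>R axis i 1 - x) $ k) \<le> norm (h $ k)"
            using insert t by (simp only: Pc) (auto simp: axis_def)
        qed
        then have "norm (P S + t *\<^sub>R axis i 1 - x) < D i"
          using y dD[of i] by (simp add: h_def)
        then show "\<bar>partial i u (P S + t *\<^sub>R axis i 1) - partial i u x\<bar> \<le> e'"
          using D(2) by (simp add: less_imp_le)
      qed
      then show ?case
        using insert unfolding eq by simp
    qed
    from this[of UNIV]
    have "\<bar>u (P UNIV) - u x - (\<Sum>i\<in>UNIV. partial i u x * h $ i)\<bar> \<le> (\<Sum>i\<in>UNIV. e' * \<bar>h $ i\<bar>)" .
    also have "\<dots> \<le> (\<Sum>i\<in>(UNIV::'n set). e' * norm h)"
      using \<open>e' > 0\<close> by (intro sum_mono mult_left_mono component_le_norm_cart) auto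
    also have "\<dots> = e * norm h"
      by (simp add: e'_def)
    also have "P UNIV = y"
      using Pc[of UNIV] by (auto simp: vec_eq_iff h_def)
    finally show ?thesis by (simp add: h_def)
  qed
  then show "\<exists>d>0. \<forall>y. norm (y - x) < d \<longrightarrow>
      norm (u y - u x - (\<Sum>i\<in>UNIV. partial i u x * (y - x) $ i)) \<le> e * norm (y - x)"
    using \<open>d > 0\<close> by auto
qed

lemma C_k_SucD:
  assumes "C_k_on_UNIV (Suc k) u"
  shows "has_partial i u x" "C_k_on_UNIV k (partial i u)"
  using assms by simp_all

lemma C_k_continuous: "C_k_on_UNIV k u \<Longrightarrow> continuous_on UNIV u"
  by (cases k) auto

text \<open>\<open>C_k_on_UNIV\<close> supplies derivatives along the axes only; arbitrary
  directions come from the total derivative and the chain rule.\<close>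

lemma C1_line_derivative:
  fixes u :: "real ^ 'n::finite \<Rightarrow> real"
  assumes "C_k_on_UNIV (Suc k) u"
  shows "((\<lambda>t. u (x + t *\<^sub>R z)) has_real_derivative (\<Sum>i\<in>UNIV. partial i u (x + t *\<^sub>R z) * z $ i)) (at t)"
proof -
  have "isCont (partial i u) y" for i y
    using C_k_continuous[OF C_k_SucD(2)[OF assms]] by (simp add: continuous_on_eq_continuous_at)
  then have "(u has_derivative (\<lambda>h. \<Sum>i\<in>UNIV. partial i u (x + t *\<^sub>R z) * h $ i)) (at (x + t *\<^sub>R z))"
    using C_k_SucD(1)[OF assms] by (intro has_derivative_partials)
  moreover have "((\<lambda>t. x + t *\<^sub>R z) has_derivative (\<lambda>s. s *\<^sub>R z)) (at t)"
    by (auto intro!: derivative_eq_intros)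
  ultimately have "((\<lambda>t. u (x + t *\<^sub>R z)) has_derivative
      (\<lambda>s. \<Sum>i\<in>UNIV. partial i u (x + t *\<^sub>R z) * (s *\<^sub>R z) $ i)) (at t)"
    using has_derivative_compose by fastforce
  moreover have "(\<lambda>s. \<Sum>i\<in>UNIV. partial i u (x + t *\<^sub>R z) * (s *\<^sub>R z) $ i) =
      (*) (\<Sum>i\<in>UNIV. partial i u (x + t *\<^sub>R z) * z $ i)"
    by (simp add: fun_eq_iff sum_distrib_left mult_ac)
  ultimately show ?thesis
    by (simp add: has_field_derivative_def)
qed

text \<open>The mean value theorem is used twice, so that the first-order terms cancel and only
  second partials remain; these are bounded on the compact ball of radius \<open>r\<close> about
  \<open>x\<close>.\<close>

lemma C2_second_difference_bound:
  fixes u :: "real ^ 'n::finite \<Rightarrow> real"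
  assumes "C_k_on_UNIV 2 u"
  obtains C where "\<And>z. norm z \<le> r \<Longrightarrow> \<bar>u (x + z) + u (x - z) - 2 * u x\<bar> \<le> C * (norm z)\<^sup>2"
proof -
  have C2: "C_k_on_UNIV (Suc (Suc 0)) u"
    using assms by (simp add: numeral_2_eq_2)
  have cont: "continuous_on UNIV (partial j (partial i u))" for i j
    using C_k_SucD(2)[OF C_k_SucD(2)[OF C2]] by simp
  have "\<exists>B. \<forall>y\<in>cball x r. \<bar>partial j (partial i u) y\<bar> \<le> B" for i j
  proof -
    have "compact ((\<lambda>y. partial j (partial i u) y) ` cball x r)"
      by (intro compact_continuous_image continuous_on_subset[OF cont]) auto
    then show ?thesis
      using bounded_iff[of "(\<lambda>y. partial j (partial i u) y) ` cball x r"] compact_imp_bounded by force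
  qed
  then have "\<forall>i j. \<exists>B. \<forall>y\<in>cball x r. \<bar>partial j (partial i u) y\<bar> \<le> B"
    by blast
  then obtain B where "\<forall>i j. \<forall>y\<in>cball x r. \<bar>partial j (partial i u) y\<bar> \<le> B i j"
    unfolding choice_iff by blast
  then have B: "\<bar>partial j (partial i u) y\<bar> \<le> B i j" if "y \<in> cball x r" for i j y
    using that by blast
  show thesis
  proof
    fix z :: "real ^ 'n"
    assume z: "norm z \<le> r"
    define g' where "g' = (\<lambda>t. \<Sum>i\<in>UNIV. partial i u (x + t *\<^sub>R z) * z $ i)"
    define g'' where "g'' = (\<lambda>t. \<Sum>i\<in>UNIV. (\<Sum>j\<in>UNIV. partial j (partial i u) (x + t *\<^sub>R z) * z $ j) * z $ i)"
    have d1: "((\<lambda>t. u (x + t *\<^sub>R z)) has_real_derivative g' t) (at t)" for t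
      unfolding g'_def by (rule C1_line_derivative[OF C2])
    have d2: "(g' has_real_derivative g'' t) (at t)" for t
      unfolding g'_def g''_def
      by (intro DERIV_sum DERIV_cmult_right C1_line_derivative[OF C_k_SucD(2)[OF C2]])
    have bound: "\<bar>g'' t\<bar> \<le> (\<Sum>i\<in>UNIV. \<Sum>j\<in>UNIV. B i j) * (norm z)\<^sup>2" if "\<bar>t\<bar> \<le> 1" for t
    proof -
      have "norm (t *\<^sub>R z) \<le> r"
        using z mult_right_mono[OF that norm_ge_zero[of z]] by simp
      then have B': "\<bar>partial j (partial i u) (x + t *\<^sub>R z)\<bar> \<le> B i j" for i j
        by (intro B) (simp add: dist_norm)
      have "\<bar>g'' t\<bar> \<le> (\<Sum>i\<in>UNIV. \<Sum>j\<in>UNIV. \<bar>partial j (partial i u) (x + t *\<^sub>R z)\<bar> * \<bar>z $ j\<bar> * \<bar>z $ i\<bar>)"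
        unfolding g''_def sum_distrib_right
        by (intro order_trans[OF sum_abs] sum_mono) (simp add: abs_mult)
      also have "\<dots> \<le> (\<Sum>i\<in>UNIV. \<Sum>j\<in>UNIV. B i j * norm z * norm z)"
        using order_trans[OF abs_ge_zero B']
        by (intro sum_mono mult_mono B' component_le_norm_cart mult_nonneg_nonneg) auto
      also have "\<dots> = (\<Sum>i\<in>UNIV. \<Sum>j\<in>UNIV. B i j) * (norm z)\<^sup>2"
        by (simp add: sum_distrib_right power2_eq_square mult.assoc)
      finally show ?thesis .
    qed
    \<comment> \<open>The first use is on the even function u(x + tz) + u(x - tz) over [0, 1]: its
      derivative is an increment of \<open>g'\<close> over \<open>[-t, t]\<close>, to which the
      theorem applies again and yields \<open>2 * t * g'' s\<close>.\<close>
    have "\<exists>t::real. 0 < t \<and> t < 1 \<and>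
        (u (x + 1 *\<^sub>R z) + u (x - 1 *\<^sub>R z)) - (u (x + 0 *\<^sub>R z) + u (x - 0 *\<^sub>R z)) = (1 - 0) * (g' t - g' (- t))"
    proof (rule MVT2)
      fix t :: real
      have "((\<lambda>t. u (x + (- t) *\<^sub>R z)) has_real_derivative - g' (- t)) (at t)"
        using DERIV_chain'[OF DERIV_minus[OF DERIV_ident] d1] by simp
      then show "((\<lambda>t. u (x + t *\<^sub>R z) + u (x - t *\<^sub>R z)) has_real_derivative g' t - g' (- t)) (at t)"
        using DERIV_add[OF d1] by fastforce
    qed simp
    then obtain t where t: "0 < t" "t < 1" "u (x + z) + u (x - z) - 2 * u x = g' t - g' (- t)"
      by auto
    obtain s where s: "- t < s" "s < t" "g' t - g' (- t) = (t - (- t)) * g'' s"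
      using MVT2[of "- t" t g' g''] d2 t(1) by auto
    have "\<bar>u (x + z) + u (x - z) - 2 * u x\<bar> = 2 * t * \<bar>g'' s\<bar>"
      using t s by (simp add: abs_mult)
    also have "\<dots> \<le> 2 * ((\<Sum>i\<in>UNIV. \<Sum>j\<in>UNIV. B i j) * (norm z)\<^sup>2)"
      using t s by (intro mult_mono bound) auto
    finally show "\<bar>u (x + z) + u (x - z) - 2 * u x\<bar> \<le> (2 * (\<Sum>i\<in>UNIV. \<Sum>j\<in>UNIV. B i j)) * (norm z)\<^sup>2"
      by simp
  qed
qed

section \<open>Quadratic domination and the second moments of the kernel\<close>

text \<open>The identity includes \<open>z = 0\<close>, where both sides are 0 because a power with
  base 0 is 0, whatever the exponent.\<close>

lemma norm_sq_div_powr: "(norm z)\<^sup>2 / norm z powr \<beta> = norm z powr (2 - \<beta>)"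
  by (cases "z = 0") (simp_all add: powr_diff powr_numeral)

text \<open>A quadratic bound leaves the majorant C |z|^(2-beta), integrable since 2 - beta > -n.
  Second moments, the even part of the difference quotient and the cosine all converge for this
  reason.\<close>

lemma set_integrable_ball_quadratic:
  fixes g :: "'a::euclidean_space \<Rightarrow> real"
  assumes "\<delta> > 0" "\<beta> < real DIM('a) + 2" and [measurable]: "g \<in> borel_measurable borel"
    and g: "\<And>z. norm z < \<delta> \<Longrightarrow> \<bar>g z\<bar> \<le> C * (norm z)\<^sup>2"
  shows "set_integrable lborel (ball 0 \<delta>) (\<lambda>z. g z / norm z powr \<beta>)"
proof (rule set_integrable_bound)
  have "integrable lborel (\<lambda>z::'a. indicator (ball 0 \<delta>) z *\<^sub>R norm z powr (2 - \<beta>))"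
    using has_bochner_integral_norm_powr_ball[of \<delta> "2 - \<beta>", where 'a = 'a] assms
    by (auto simp: has_bochner_integral_iff)
  then show "set_integrable lborel (ball 0 \<delta>) (\<lambda>z::'a. C * norm z powr (2 - \<beta>))"
    unfolding set_integrable_def[symmetric] by (rule set_integrable_mult_right)
  show "set_borel_measurable lborel (ball 0 \<delta>) (\<lambda>z. g z / norm z powr \<beta>)"
    unfolding set_borel_measurable_def
    by (intro borel_measurable_scaleR borel_measurable_indicator borel_measurable_divide) auto
  show "AE z in lborel. z \<in> ball 0 \<delta> \<longrightarrow>
      norm (g z / norm z powr \<beta>) \<le> norm (C * norm z powr (2 - \<beta>))"
  proof (intro AE_I2 impI)
    fix z :: 'a
    assume "z \<in> ball 0 \<delta>"
    then have "\<bar>g z\<bar> / norm z powr \<beta> \<le> (C * (norm z)\<^sup>2) / norm z powr \<beta>"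
      by (intro divide_right_mono g) auto
    also have "\<dots> = C * norm z powr (2 - \<beta>)"
      using norm_sq_div_powr[of z \<beta>] by (simp only: times_divide_eq_right[symmetric])
    finally show "norm (g z / norm z powr \<beta>) \<le> norm (C * norm z powr (2 - \<beta>))"
      by (simp add: abs_divide)
  qed
qed

context
  fixes \<delta> \<beta> :: real
  assumes \<delta>: "\<delta> > 0"
begin

definition second_moment :: "'n::finite \<Rightarrow> 'n \<Rightarrow> real" where
  "second_moment i j = (LINT z:ball 0 \<delta>|lborel. z $ i * z $ j / norm z powr \<beta>)"

lemma set_integrable_second_moment:
  assumes "\<beta> < real CARD('n::finite) + 2"
  shows "set_integrable lborel (ball 0 \<delta>) (\<lambda>z :: real ^ 'n. z $ i * z $ j / norm z powr \<beta>)"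
proof (rule set_integrable_ball_quadratic[where C = 1])
  show "\<bar>z $ i * z $ j\<bar> \<le> 1 * (norm z)\<^sup>2" for z :: "real ^ 'n"
    unfolding abs_mult power2_eq_square mult_1
    by (intro mult_mono component_le_norm_cart) auto
qed (use \<delta> assms in auto)

text \<open>The substitution preserves the measure, the ball and the norm, and turns z_i z_j into
  s_i s_j z_(p i) z_(p j). If one integrand fails to be integrable, so does the other, and both
  integrals have the default value 0.\<close>

lemma second_moment_signed_perm:
  fixes s :: "'n::finite \<Rightarrow> real" and p :: "'n \<Rightarrow> 'n"
  assumes s: "\<And>k. \<bar>s k\<bar> = 1" and p: "bij p"
  shows "second_moment i j = s i * s j * second_moment (p i) (p j)"
proof -
  let ?f = "\<lambda>z :: real ^ 'n. indicator (ball 0 \<delta>) z *\<^sub>R (z $ i * z $ j / norm z powr \<beta>)"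
  let ?T = "\<lambda>z :: real ^ 'n. (\<chi> k. s k * z $ p k) :: real ^ 'n"
  have "second_moment i j = (\<integral>z. ?f z \<partial>lborel)"
    by (simp add: second_moment_def set_lebesgue_integral_def)
  also have "\<dots> = (\<integral>z. ?f (?T z) \<partial>lborel)"
    by (rule integral_signed_perm(1)[OF s p, symmetric], intro borel_measurable_scaleR
        borel_measurable_indicator borel_measurable_divide borel_measurable_times) auto
  also have "\<dots> = (\<integral>z. (s i * s j) * (indicator (ball 0 \<delta>) z *\<^sub>R (z $ p i * z $ p j / norm z powr \<beta>)) \<partial>lborel)"
    by (intro Bochner_Integration.integral_cong)
      (auto simp: norm_signed_perm s p split: split_indicator)
  also have "\<dots> = s i * s j * second_moment (p i) (p j)"
    unfolding second_moment_def set_lebesgue_integral_def by (rule integral_mult_right_zero)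
  finally show ?thesis .
qed

text \<open>Flipping the sign of coordinate \<open>i\<close> alone shows that the moment equals its
  own negative.\<close>

lemma second_moment_off_diagonal:
  assumes "i \<noteq> j"
  shows "second_moment i j = 0"
  using second_moment_signed_perm[of "\<lambda>k. if k = i then -1 else 1" id i j] assms by auto

text \<open>Transpositions make the n diagonal moments equal, and their sum is the integral of
  |z|^(2-beta). As the unit ball has volume pi^(n/2) / Gamma(n/2 + 1), each moment is 2 divided by
  the scaling constant; the 2 compensates for the half in z (x) z / 2.\<close>

lemma second_moment_diagonal:
  assumes "\<beta> < real CARD('n::finite) + 2"
  shows "scaling_const CARD('n) \<delta> \<beta> * second_moment (i :: 'n) i = 2"
proof -
  let ?n = "real CARD('n)"
  have diag: "second_moment k k = second_moment i i" for k :: 'n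
  proof -
    have "bij (Transposition.transpose i k)"
      by simp
    then show ?thesis
      using second_moment_signed_perm[of "\<lambda>_. 1" "Transposition.transpose i k" k k] by simp
  qed
  then have "?n * second_moment i i = (\<Sum>k\<in>(UNIV :: 'n set). second_moment k k)"
    by (subst sum.cong[OF refl diag]) simp
  also have "\<dots> = (LINT z:ball (0 :: real ^ 'n) \<delta>|lborel. (\<Sum>k\<in>UNIV. z $ k * z $ k / norm z powr \<beta>))"
    unfolding second_moment_def set_lebesgue_integral_def scaleR_sum_right
    by (rule Bochner_Integration.integral_sum[symmetric])
      (rule set_integrable_second_moment[OF assms, unfolded set_integrable_def])
  also have "\<dots> = (LINT z:ball (0 :: real ^ 'n) \<delta>|lborel. norm z powr (2 - \<beta>))"
  proof -
    have "(\<Sum>k\<in>UNIV. z $ k * z $ k / norm z powr \<beta>) = norm z powr (2 - \<beta>)" for z :: "real ^ 'n"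
      unfolding norm_sq_div_powr[symmetric] sum_divide_distrib[symmetric]
      by (simp add: power2_norm_eq_inner inner_vec_def)
    then show ?thesis by simp
  qed
  also have "\<dots> = ?n * unit_ball_vol ?n * \<delta> powr (?n + (2 - \<beta>)) / (?n + (2 - \<beta>))"
    using has_bochner_integral_norm_powr_ball[of \<delta> "2 - \<beta>", where 'a = "real ^ 'n"] assms \<delta>
    by (auto simp: has_bochner_integral_iff set_lebesgue_integral_def)
  finally have "?n * second_moment i i =
      ?n * (unit_ball_vol ?n * \<delta> powr (?n + 2 - \<beta>) / (?n + 2 - \<beta>))"
    by (simp add: add_diff_eq mult.assoc)
  then have m: "second_moment i i = unit_ball_vol ?n * \<delta> powr (?n + 2 - \<beta>) / (?n + 2 - \<beta>)"
    by (simp only: mult_cancel_left) simp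
  \<comment> \<open>\<open>N\<close> stands for n + 2 - beta, \<open>G\<close> for the Gamma value,
    \<open>P\<close> for the power of pi and \<open>D\<close> for the power of delta; the first
    factor is the scaling constant, the second the moment.\<close>
  have cancel: "2 * N * G / (P * D) * (P / G * D / N) = 2"
    if "N \<noteq> 0" "G \<noteq> 0" "P \<noteq> 0" "D \<noteq> 0" for N G P D :: real
    using that by simp
  have "Gamma (?n / 2 + 1) > 0"
    by (intro Gamma_real_pos) (simp add: add_pos_pos)
  then have "Gamma (?n / 2 + 1) \<noteq> 0"
    by (rule less_imp_neq[symmetric])
  then have "scaling_const CARD('n) \<delta> \<beta> *
      (unit_ball_vol ?n * \<delta> powr (?n + 2 - \<beta>) / (?n + 2 - \<beta>)) = 2"
    unfolding scaling_const_def unit_ball_vol_def using assms \<delta> by (intro cancel) auto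
  then show ?thesis
    by (simp only: m)
qed

text \<open>Both identities rest on this: with the Hessian for \<open>A\<close> the trace is the
  Laplacian, with the outer square of a vector it is the squared norm. Expanding the contraction
  leaves only the diagonal moments.\<close>

lemma contract_integral:
  fixes A :: "real ^ 'n::finite ^ 'n"
  assumes "\<beta> < real CARD('n) + 2"
  defines "q \<equiv> \<lambda>z. contract A ((1 / 2) *\<^sub>R outer_prod z z) / norm z powr \<beta>"
  shows "set_integrable lborel (ball 0 \<delta>) q"
    and "scaling_const CARD('n) \<delta> \<beta> * (LINT z:ball 0 \<delta>|lborel. q z) = (\<Sum>i\<in>UNIV. A $ i $ i)"
proof -
  have q: "q z = (\<Sum>i\<in>UNIV. \<Sum>j\<in>UNIV. A $ i $ j / 2 * (z $ i * z $ j / norm z powr \<beta>))" for z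
    by (simp add: q_def contract_def outer_prod_def sum_divide_distrib)
  have m: "has_bochner_integral lborel
      (\<lambda>z. indicator (ball 0 \<delta>) z *\<^sub>R (z $ i * z $ j / norm z powr \<beta>)) (second_moment i j)" for i j :: 'n
    using set_integrable_second_moment[OF assms(1)]
    by (simp only: has_bochner_integral_iff second_moment_def set_lebesgue_integral_def
        set_integrable_def)
  have "has_bochner_integral lborel (\<lambda>z. indicator (ball 0 \<delta>) z *\<^sub>R q z)
      (\<Sum>i\<in>UNIV. \<Sum>j\<in>UNIV. A $ i $ j / 2 * second_moment i j)"
    unfolding q scaleR_sum_right mult_scaleR_right[symmetric]
    by (intro has_bochner_integral_sum has_bochner_integral_mult_right m)
  moreover have "(\<Sum>i\<in>UNIV. \<Sum>j\<in>UNIV. A $ i $ j / 2 * second_moment i j) =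
      (\<Sum>i\<in>UNIV. A $ i $ i / 2 * second_moment i i)"
  proof (intro sum.cong refl)
    fix i :: 'n
    have "(\<Sum>j\<in>UNIV. A $ i $ j / 2 * second_moment i j) =
        (\<Sum>j\<in>UNIV. if i = j then A $ i $ i / 2 * second_moment i i else 0)"
      by (intro sum.cong) (auto simp: second_moment_off_diagonal)
    then show "(\<Sum>j\<in>UNIV. A $ i $ j / 2 * second_moment i j) = A $ i $ i / 2 * second_moment i i"
      by simp
  qed
  ultimately have *: "has_bochner_integral lborel (\<lambda>z. indicator (ball 0 \<delta>) z *\<^sub>R q z)
      (\<Sum>i\<in>UNIV. A $ i $ i / 2 * second_moment i i)"
    by simp
  then show "set_integrable lborel (ball 0 \<delta>) q"
    by (simp add: set_integrable_def has_bochner_integral_iff)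
  have "scaling_const CARD('n) \<delta> \<beta> * (A $ i $ i / 2 * second_moment i i) = A $ i $ i" for i
    using second_moment_diagonal[OF assms(1), of i] by (simp add: algebra_simps)
  then show "scaling_const CARD('n) \<delta> \<beta> * (LINT z:ball 0 \<delta>|lborel. q z) = (\<Sum>i\<in>UNIV. A $ i $ i)"
    using * by (simp only: set_lebesgue_integral_def has_bochner_integral_iff sum_distrib_left)
qed

end

section \<open>Principal values and the difference quotient\<close>

text \<open>Away from the null set \<open>{0}\<close> every point of the ball eventually lies in the
  annulus, so dominated convergence applies. Principal values thus extend the Lebesgue
  integral.\<close>

lemma has_pv_integral_LINT:
  fixes f :: "real ^ 'n::finite \<Rightarrow> real"
  assumes f: "set_integrable lborel (ball 0 \<delta>) f"
  shows "has_pv_integral \<delta> f (LINT z:ball 0 \<delta>|lborel. f z)"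
  unfolding has_pv_integral_def
proof (intro conjI allI impI)
  show int: "set_integrable lborel (ball 0 \<delta> - ball 0 \<epsilon>) f" for \<epsilon>
    using f by (rule set_integrable_subset) auto
  show "((\<lambda>\<epsilon>. LINT z:(ball 0 \<delta> - ball 0 \<epsilon>)|lborel. f z) \<longlongrightarrow> (LINT z:ball 0 \<delta>|lborel. f z)) (at_right 0)"
  \<comment> \<open>Dominated convergence concerns sequences, so the one-sided limit is tested along
    sequences in (0, 1) that decrease to 0.\<close>
  proof (rule tendsto_at_right_sequentially[of 0 1])
    fix S :: "nat \<Rightarrow> real"
    assume S: "S \<longlonglongrightarrow> 0"
    show "(\<lambda>n. LINT z:(ball 0 \<delta> - ball 0 (S n))|lborel. f z) \<longlonglongrightarrow> (LINT z:ball 0 \<delta>|lborel. f z)"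
      unfolding set_lebesgue_integral_def
    proof (rule integral_dominated_convergence[where w = "\<lambda>z. norm (indicator (ball 0 \<delta>) z *\<^sub>R f z)"])
      show "(\<lambda>z. indicator (ball 0 \<delta>) z *\<^sub>R f z) \<in> borel_measurable lborel"
        using f unfolding set_integrable_def by (rule borel_measurable_integrable)
      show "(\<lambda>z. indicator (ball 0 \<delta> - ball 0 (S n)) z *\<^sub>R f z) \<in> borel_measurable lborel" for n
        using int[of "S n"] unfolding set_integrable_def by (rule borel_measurable_integrable)
      show "integrable lborel (\<lambda>z. norm (indicator (ball 0 \<delta>) z *\<^sub>R f z))"
        using f unfolding set_integrable_def by (rule integrable_norm)
      show "AE z in lborel. (\<lambda>n. indicator (ball 0 \<delta> - ball 0 (S n)) z *\<^sub>R f z)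
          \<longlonglongrightarrow> indicator (ball 0 \<delta>) z *\<^sub>R f z"
        using AE_lborel_singleton[of "0 :: real ^ 'n"]
      proof eventually_elim
        fix z :: "real ^ 'n"
        assume "z \<noteq> 0"
        then have "eventually (\<lambda>n. S n < norm z) sequentially"
          using order_tendstoD(2)[OF S, of "norm z"] by simp
        then have "eventually (\<lambda>n. indicator (ball 0 \<delta> - ball 0 (S n)) z *\<^sub>R f z =
            indicator (ball 0 \<delta>) z *\<^sub>R f z) sequentially"
          by eventually_elim (auto split: split_indicator)
        then show "(\<lambda>n. indicator (ball 0 \<delta> - ball 0 (S n)) z *\<^sub>R f z) \<longlonglongrightarrow> indicator (ball 0 \<delta>) z *\<^sub>R f z"
          by (rule tendsto_eventually)
      qed
      show "AE z in lborel. norm (indicator (ball 0 \<delta> - ball 0 (S n)) z *\<^sub>R f z)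
          \<le> norm (indicator (ball 0 \<delta>) z *\<^sub>R f z)" for n
        by (auto split: split_indicator)
    qed
  qed simp
qed

lemma has_pv_integral_unique:
  assumes "has_pv_integral \<delta> f I" "has_pv_integral \<delta> f J"
  shows "I = J"
  using assms unfolding has_pv_integral_def
  by (meson tendsto_unique trivial_limit_at_right_real)

text \<open>The two branches of \<open>sing_integral\<close> agree: under absolute convergence the
  Lebesgue integral is itself a principal value, hence equal to \<open>I\<close> by
  uniqueness.\<close>

lemma has_pv_integral_sing:
  assumes "has_pv_integral \<delta> f I"
  shows "sing_convergent \<delta> f" "sing_integral \<delta> f = I"
proof -
  show "sing_convergent \<delta> f"
    using assms by (auto simp: sing_convergent_def)
  have "(THE I. has_pv_integral \<delta> f I) = I"
    using assms has_pv_integral_unique by blast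
  then show "sing_integral \<delta> f = I"
    using has_pv_integral_unique[OF has_pv_integral_LINT assms] by (simp add: sing_integral_def)
qed

text \<open>Linearity is wanted for principal values because the difference quotient of
  \<open>u\<close> may fail to be absolutely integrable.\<close>

lemma has_pv_integral_diff:
  assumes "has_pv_integral \<delta> f I" "has_pv_integral \<delta> g J"
  shows "has_pv_integral \<delta> (\<lambda>z. f z - g z) (I - J)"
  unfolding has_pv_integral_def
proof (intro conjI allI impI)
  have int: "set_integrable lborel (ball 0 \<delta> - ball 0 \<epsilon>) f"
    "set_integrable lborel (ball 0 \<delta> - ball 0 \<epsilon>) g" if "\<epsilon> > 0" for \<epsilon>
    using assms that by (auto simp: has_pv_integral_def)
  then show "set_integrable lborel (ball 0 \<delta> - ball 0 \<epsilon>) (\<lambda>z. f z - g z)" if "\<epsilon> > 0" for \<epsilon>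
    using that by (intro set_integral_diff)
  have "eventually (\<lambda>\<epsilon>. (LINT z:(ball 0 \<delta> - ball 0 \<epsilon>)|lborel. f z) - (LINT z:(ball 0 \<delta> - ball 0 \<epsilon>)|lborel. g z) =
      (LINT z:(ball 0 \<delta> - ball 0 \<epsilon>)|lborel. f z - g z)) (at_right 0)"
    using eventually_at_right_less[of "0::real"]
    by eventually_elim (auto simp: set_integral_diff int)
  then show "((\<lambda>\<epsilon>. LINT z:(ball 0 \<delta> - ball 0 \<epsilon>)|lborel. f z - g z) \<longlongrightarrow> I - J) (at_right 0)"
    using assms unfolding has_pv_integral_def
    by (elim Lim_transform_eventually[rotated] conjE) (intro tendsto_diff)
qed

text \<open>Reflection in the origin is the signed permutation with all signs -1 and the identity as
  permutation.\<close>

lemma set_integral_uminus_arg: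
  fixes f :: "real ^ 'n::finite \<Rightarrow> real"
  assumes [measurable]: "f \<in> borel_measurable borel" "A \<in> sets borel"
    and A: "\<And>z. - z \<in> A \<longleftrightarrow> z \<in> A"
  shows "set_integrable lborel A (\<lambda>z. f (- z)) \<longleftrightarrow> set_integrable lborel A f"
    and "(LINT z:A|lborel. f (- z)) = (LINT z:A|lborel. f z)"
proof -
  have m: "(\<lambda>z. indicator A z *\<^sub>R f z) \<in> borel_measurable borel" by measurable
  have neg: "(\<chi> k. (-1) * z $ id k) = - z" for z :: "real ^ 'n"
    by (simp add: vec_eq_iff)
  have ind: "indicator A (- z) = (indicator A z :: real)" for z
    using A by (simp add: indicator_def)
  show "set_integrable lborel A (\<lambda>z. f (- z)) \<longleftrightarrow> set_integrable lborel A f"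
    and "(LINT z:A|lborel. f (- z)) = (LINT z:A|lborel. f z)"
    using integral_signed_perm[of "\<lambda>_. -1" id, OF _ _ m]
    unfolding neg ind set_integrable_def set_lebesgue_integral_def by simp_all
qed

text \<open>On an annulus \<open>f\<close> and its reflection have equal integrals, so the integral
  of \<open>f\<close> is half that of the symmetrised function, whose absolute integrability on the
  ball gives the limit.\<close>

lemma has_pv_integral_symmetrise:
  fixes f :: "real ^ 'n::finite \<Rightarrow> real"
  assumes [measurable]: "f \<in> borel_measurable borel"
    and ann: "\<And>\<epsilon>. \<epsilon> > 0 \<Longrightarrow> set_integrable lborel (ball 0 \<delta> - ball 0 \<epsilon>) f"
    and sym: "set_integrable lborel (ball 0 \<delta>) (\<lambda>z. f z + f (- z))"
  shows "has_pv_integral \<delta> f ((LINT z:ball 0 \<delta>|lborel. f z + f (- z)) / 2)"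
  unfolding has_pv_integral_def
proof (intro conjI allI impI ann)
  have "eventually (\<lambda>\<epsilon>. (LINT z:(ball 0 \<delta> - ball 0 \<epsilon>)|lborel. f z + f (- z)) / 2 =
      (LINT z:(ball 0 \<delta> - ball 0 \<epsilon>)|lborel. f z)) (at_right 0)"
    using eventually_at_right_less[of "0::real"]
  proof eventually_elim
    fix \<epsilon> :: real
    assume "0 < \<epsilon>"
    then show "(LINT z:(ball 0 \<delta> - ball 0 \<epsilon>)|lborel. f z + f (- z)) / 2 =
      (LINT z:(ball 0 \<delta> - ball 0 \<epsilon>)|lborel. f z)"
      using ann[of \<epsilon>] set_integral_uminus_arg[of f "ball 0 \<delta> - ball 0 \<epsilon>"]
      by (simp add: set_integral_add)
  qed
  then show "((\<lambda>\<epsilon>. LINT z:(ball 0 \<delta> - ball 0 \<epsilon>)|lborel. f z) \<longlongrightarrow>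
      (LINT z:ball 0 \<delta>|lborel. f z + f (- z)) / 2) (at_right 0)"
    using has_pv_integral_LINT[OF sym] unfolding has_pv_integral_def
    by (elim Lim_transform_eventually[rotated] conjE) (intro tendsto_divide tendsto_const, auto)
qed

text \<open>For beta >= n + 1 the gradient term can destroy absolute convergence. Symmetrising
  removes it and leaves the second difference, which is bounded quadratically.\<close>

lemma has_pv_integral_increment:
  fixes u :: "real ^ 'n::finite \<Rightarrow> real"
  assumes "\<delta> > 0" "\<beta> < real CARD('n) + 2" and u: "C_k_on_UNIV 2 u"
  obtains I where "has_pv_integral \<delta> (\<lambda>z. (u (x + z) - u x) / norm z powr \<beta>) I"
proof -
  let ?f = "\<lambda>z. (u (x + z) - u x) / norm z powr \<beta>"
  have cont: "continuous_on UNIV u"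
    using u by (rule C_k_continuous)
  have cont': "continuous_on S (\<lambda>z. u (x + z))" "continuous_on S (\<lambda>z. u (x - z))" for S
    by (auto intro!: continuous_on_compose2[OF cont] continuous_intros)
  have [measurable]: "(\<lambda>z. u (x + z)) \<in> borel_measurable borel" "(\<lambda>z. u (x - z)) \<in> borel_measurable borel"
    by (intro borel_measurable_continuous_onI cont')+
  obtain C where C: "\<And>z. norm z \<le> \<delta> \<Longrightarrow> \<bar>u (x + z) + u (x - z) - 2 * u x\<bar> \<le> C * (norm z)\<^sup>2"
    using C2_second_difference_bound[OF u] by blast
  have "set_integrable lborel (ball 0 \<delta>) (\<lambda>z. (u (x + z) + u (x - z) - 2 * u x) / norm z powr \<beta>)"
    using assms by (intro set_integrable_ball_quadratic[where C = C] C) auto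
  also have "(\<lambda>z. (u (x + z) + u (x - z) - 2 * u x) / norm z powr \<beta>) = (\<lambda>z. ?f z + ?f (- z))"
    by (simp add: add_divide_distrib diff_divide_distrib fun_eq_iff)
  finally have sym: "set_integrable lborel (ball 0 \<delta>) (\<lambda>z. ?f z + ?f (- z))" .
  have ann: "set_integrable lborel (ball 0 \<delta> - ball 0 \<epsilon>) ?f" if "\<epsilon> > 0" for \<epsilon>
  proof (rule set_integrable_subset)
    \<comment> \<open>The closed annulus is compact and stays away from the singularity, so the
      integrand is continuous on it.\<close>
    show "set_integrable lborel (cball 0 \<delta> - ball 0 \<epsilon>) ?f"
      unfolding set_integrable_def
      using that
      by (intro borel_integrable_compact compact_diff continuous_intros cont') auto
  qed auto
  show thesis
    by (rule that, rule has_pv_integral_symmetrise[OF _ ann sym]) measurable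
qed

section \<open>The cosine and the two identities\<close>

text \<open>By the half-angle formula, 1 - cos t is twice the square of sin (t/2).\<close>

lemma abs_cos_minus_one_le: "\<bar>cos t - 1\<bar> \<le> t\<^sup>2 / 2" for t :: real
proof -
  have "\<bar>cos t - 1\<bar> = 2 * (sin (t / 2))\<^sup>2"
    using cos_double_sin[of "t / 2"] by simp
  also have "\<dots> \<le> 2 * (t / 2)\<^sup>2"
    using abs_sin_x_le_abs_x[of "t / 2"] by (intro mult_left_mono) (auto simp: abs_le_square_iff[symmetric])
  finally show ?thesis by (simp add: power2_eq_square)
qed

text \<open>This presents the quadratic term of the cosine as a contraction, so that
  \<open>contract_integral\<close> serves the second identity as well.\<close>

lemma contract_outer_prod:
  "contract (outer_prod \<nu> \<nu>) ((1 / 2) *\<^sub>R outer_prod z z) = (\<nu> \<bullet> z)\<^sup>2 / 2"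
  by (simp add: contract_def outer_prod_def inner_vec_def power2_eq_square sum_product
      sum_divide_distrib mult_ac)

theorem proposition1:
  fixes \<delta> \<beta> :: real
  assumes "\<delta> > 0" and "\<beta> < real CARD('n::finite) + 2"
  shows "(\<forall>(u :: real ^ 'n \<Rightarrow> real) (x :: real ^ 'n). C_k_on_UNIV 2 u \<longrightarrow>
      sing_convergent \<delta> (\<lambda>z. (u (x + z) - u x
        - contract (hessian u x) ((1 / 2) *\<^sub>R outer_prod z z)) / norm z powr \<beta>) \<and>
      sing_convergent \<delta> (\<lambda>z. (u (x + z) - u x) / norm z powr \<beta>) \<and>
      laplacian u x + scaling_const CARD('n) \<delta> \<beta> *
        sing_integral \<delta> (\<lambda>z. (u (x + z) - u x
          - contract (hessian u x) ((1 / 2) *\<^sub>R outer_prod z z)) / norm z powr \<beta>)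
      = scaling_const CARD('n) \<delta> \<beta> *
        sing_integral \<delta> (\<lambda>z. (u (x + z) - u x) / norm z powr \<beta>))
    \<and> (\<forall>\<nu> :: real ^ 'n.
      set_integrable lborel (ball 0 \<delta>)
        (\<lambda>z. (cos (\<nu> \<bullet> z) - 1 + (\<nu> \<bullet> z)\<^sup>2 / 2) / norm z powr \<beta>) \<and>
      set_integrable lborel (ball 0 \<delta>) (\<lambda>z. (cos (\<nu> \<bullet> z) - 1) / norm z powr \<beta>) \<and>
      - (norm \<nu>)\<^sup>2 + scaling_const CARD('n) \<delta> \<beta> *
        (LINT z:ball 0 \<delta>|lborel. (cos (\<nu> \<bullet> z) - 1 + (\<nu> \<bullet> z)\<^sup>2 / 2) / norm z powr \<beta>)
      = scaling_const CARD('n) \<delta> \<beta> *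
        (LINT z:ball 0 \<delta>|lborel. (cos (\<nu> \<bullet> z) - 1) / norm z powr \<beta>))"
proof (intro conjI[of "\<forall>u x. _ u x"] allI impI)
  fix u :: "real ^ 'n \<Rightarrow> real" and x :: "real ^ 'n"
  assume u: "C_k_on_UNIV 2 u"
  let ?c = "scaling_const CARD('n) \<delta> \<beta>"
  let ?f = "\<lambda>z. (u (x + z) - u x) / norm z powr \<beta>"
  let ?q = "\<lambda>z. contract (hessian u x) ((1 / 2) *\<^sub>R outer_prod z z) / norm z powr \<beta>"
  let ?J = "LINT z:ball 0 \<delta>|lborel. ?q z"
  obtain I where I: "has_pv_integral \<delta> ?f I"
    using has_pv_integral_increment[OF assms u] .
  have "has_pv_integral \<delta> (\<lambda>z. ?f z - ?q z) (I - ?J)"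
    using I has_pv_integral_LINT[OF contract_integral(1)[OF assms]] by (rule has_pv_integral_diff)
  then have D: "has_pv_integral \<delta> (\<lambda>z. (u (x + z) - u x
      - contract (hessian u x) ((1 / 2) *\<^sub>R outer_prod z z)) / norm z powr \<beta>) (I - ?J)"
    by (simp only: diff_divide_distrib)
  \<comment> \<open>Adding the Laplacian restores exactly the \<open>?c * ?J\<close> that is lost in
    passing from \<open>I\<close> to \<open>I - ?J\<close>.\<close>
  have "?c * ?J = laplacian u x"
    using contract_integral(2)[OF assms, of "hessian u x"] by (simp add: hessian_def laplacian_def)
  then show "sing_convergent \<delta> (\<lambda>z. (u (x + z) - u x
        - contract (hessian u x) ((1 / 2) *\<^sub>R outer_prod z z)) / norm z powr \<beta>) \<and>
      sing_convergent \<delta> ?f \<and>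
      laplacian u x + ?c * sing_integral \<delta> (\<lambda>z. (u (x + z) - u x
          - contract (hessian u x) ((1 / 2) *\<^sub>R outer_prod z z)) / norm z powr \<beta>)
      = ?c * sing_integral \<delta> ?f"
    using has_pv_integral_sing[OF I] has_pv_integral_sing[OF D] by (simp add: right_diff_distrib)
next
  fix \<nu> :: "real ^ 'n"
  let ?c = "scaling_const CARD('n) \<delta> \<beta>"
  let ?f = "\<lambda>z. (cos (\<nu> \<bullet> z) - 1) / norm z powr \<beta>"
  let ?q = "\<lambda>z. (\<nu> \<bullet> z)\<^sup>2 / 2 / norm z powr \<beta>"
  \<comment> \<open>Here convergence is absolute: cos t - 1 has no linear term, and Cauchy-Schwarz
    makes the bound quadratic in \<open>z\<close>.\<close>
  have f: "set_integrable lborel (ball 0 \<delta>) ?f"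
  proof (rule set_integrable_ball_quadratic)
    fix z :: "real ^ 'n"
    have "\<bar>cos (\<nu> \<bullet> z) - 1\<bar> \<le> (\<nu> \<bullet> z)\<^sup>2 / 2"
      by (rule abs_cos_minus_one_le)
    also have "\<dots> \<le> (norm \<nu> * norm z)\<^sup>2 / 2"
      using Cauchy_Schwarz_ineq2[of \<nu> z] by (intro divide_right_mono) (auto simp: abs_le_square_iff[symmetric])
    finally show "\<bar>cos (\<nu> \<bullet> z) - 1\<bar> \<le> (norm \<nu>)\<^sup>2 / 2 * (norm z)\<^sup>2"
      by (simp add: power_mult_distrib)
  qed (use assms in auto)
  note q = contract_integral[OF assms, of "outer_prod \<nu> \<nu>", unfolded contract_outer_prod]
  have "(\<Sum>i\<in>UNIV. outer_prod \<nu> \<nu> $ i $ i) = (norm \<nu>)\<^sup>2"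
    by (simp add: outer_prod_def power2_norm_eq_inner inner_vec_def)
  \<comment> \<open>The quadratic term is added to the integrand here instead of subtracted, which
    is why the squared norm enters with a minus sign.\<close>
  then have "?c * (LINT z:ball 0 \<delta>|lborel. ?q z) = (norm \<nu>)\<^sup>2"
    using q(2) by simp
  then show "set_integrable lborel (ball 0 \<delta>)
        (\<lambda>z. (cos (\<nu> \<bullet> z) - 1 + (\<nu> \<bullet> z)\<^sup>2 / 2) / norm z powr \<beta>) \<and>
      set_integrable lborel (ball 0 \<delta>) ?f \<and>
      - (norm \<nu>)\<^sup>2 + ?c *
        (LINT z:ball 0 \<delta>|lborel. (cos (\<nu> \<bullet> z) - 1 + (\<nu> \<bullet> z)\<^sup>2 / 2) / norm z powr \<beta>)
      = ?c * (LINT z:ball 0 \<delta>|lborel. ?f z)"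
    using f q(1) set_integral_add[OF f q(1)]
    by (simp only: add_divide_distrib) (simp add: distrib_left)
qed

end
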